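(* Let $p\ge q\ge 1$ be integers and let $S_{p,q}$ be the double star. Then $\chi'_L(S_{p,q})=p+1$ if $p>q$, and $\chi'_L(S_{p,q})=p+2$ if $p=q$.
   Context: The double star $S_{p,q}$ is the tree consisting of two adjacent vertices $v,u$, where $v$ is adjacent to $p$ further leaves and $u$ is adjacent to $q$ further leaves. For a proper edge coloring $c:E(G)\to\{1,\dots,k\}$ of a connected graph $G$, let $\pi=(\mathcal{C}_1,\dots,\mathcal{C}_k)$ be the ordered partition of $E(G)$ into color classes. For a vertex $v$ and an edge $e=xy$, $d(v,e)=\min\{d(v,x),d(v,y)\}$, and $d(v,\mathcal{C}_i)=\min\{d(v,e): e\in\mathcal{C}_i\}$. The edge color code of $v$ is $c_\pi(v)=(d(v,\mathcal{C}_1),\dots,d(v,\mathcal{C}_k))$. The coloring is an edge-locating coloring if distinct vertices have distinct edge color codes; $\chi'_L(G)$ is the minimum number of colors in an edge-locating coloring of $G$. *)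

theory Defs
  imports Main
begin

text \<open>
  A finite simple graph is given by its vertex set \<open>V\<close> and its set \<open>E\<close> of edges, each edge being
  the two-element set of its endpoints.
\<close>

definition walk :: "'a set \<Rightarrow> 'a set set \<Rightarrow> 'a list \<Rightarrow> bool" where
  "walk V E xs \<longleftrightarrow> xs \<noteq> [] \<and> set xs \<subseteq> V \<and> successively (\<lambda>x y. {x, y} \<in> E) xs"

text \<open>The \<open>LEAST\<close> is meaningful only for vertices in the same connected component.\<close>

definition vdist :: "'a set \<Rightarrow> 'a set set \<Rightarrow> 'a \<Rightarrow> 'a \<Rightarrow> nat" where
  "vdist V E x y =
     (LEAST n. \<exists>xs. walk V E xs \<and> hd xs = x \<and> last xs = y \<and> length xs = Suc n)"

definition edge_dist :: "'a set \<Rightarrow> 'a set set \<Rightarrow> 'a \<Rightarrow> 'a set \<Rightarrow> nat" where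
  "edge_dist V E v e = Min (vdist V E v ` e)"

definition color_class :: "'a set set \<Rightarrow> ('a set \<Rightarrow> nat) \<Rightarrow> nat \<Rightarrow> 'a set set" where
  "color_class E c i = {e \<in> E. c e = i}"

definition class_dist :: "'a set \<Rightarrow> 'a set set \<Rightarrow> 'a \<Rightarrow> 'a set set \<Rightarrow> nat" where
  "class_dist V E v C = Min (edge_dist V E v ` C)"

definition edge_color_code ::
  "'a set \<Rightarrow> 'a set set \<Rightarrow> ('a set \<Rightarrow> nat) \<Rightarrow> nat \<Rightarrow> 'a \<Rightarrow> nat list" where
  "edge_color_code V E c k v = map (\<lambda>i. class_dist V E v (color_class E c i)) [1..<Suc k]"

text \<open>
  The color classes are the parts of a partition of \<open>E\<close>, so every one of the \<open>k\<close> colors is used.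
  This also guarantees that the minima in the codes range over nonempty sets.
\<close>

definition proper_edge_coloring :: "'a set set \<Rightarrow> ('a set \<Rightarrow> nat) \<Rightarrow> nat \<Rightarrow> bool" where
  "proper_edge_coloring E c k \<longleftrightarrow>
     c ` E = {1..k} \<and>
     (\<forall>e\<in>E. \<forall>f\<in>E. e \<noteq> f \<and> e \<inter> f \<noteq> {} \<longrightarrow> c e \<noteq> c f)"

definition edge_locating_coloring ::
  "'a set \<Rightarrow> 'a set set \<Rightarrow> ('a set \<Rightarrow> nat) \<Rightarrow> nat \<Rightarrow> bool" where
  "edge_locating_coloring V E c k \<longleftrightarrow>
     proper_edge_coloring E c k \<and> inj_on (edge_color_code V E c k) V"

definition edge_locating_chromatic_number :: "'a set \<Rightarrow> 'a set set \<Rightarrow> nat" where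
  "edge_locating_chromatic_number V E = (LEAST k. \<exists>c. edge_locating_coloring V E c k)"

text \<open>
  \<open>(V, E)\<close> is a copy of the double star with parameters \<open>p\<close> and \<open>q\<close>: its centers are \<open>v\<close> and
  \<open>u\<close>, with leaf sets \<open>A\<close> and \<open>B\<close> respectively.
\<close>

definition double_star :: "nat \<Rightarrow> nat \<Rightarrow> 'a set \<Rightarrow> 'a set set \<Rightarrow> bool" where
  "double_star p q V E \<longleftrightarrow>
     (\<exists>v u A B.
        v \<noteq> u \<and> finite A \<and> card A = p \<and> finite B \<and> card B = q \<and>
        A \<inter> B = {} \<and> {v, u} \<inter> (A \<union> B) = {} \<and>
        V = {v, u} \<union> A \<union> B \<and>
        E = {{v, u}} \<union> {{v, x} | x. x \<in> A} \<union> {{u, y} | y. y \<in> B})"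

lemma double_star_exists: "\<exists>(V :: nat set) E. double_star p q V E"
proof -
  let ?A = "{2..<p + 2}" and ?B = "{p + 2..<p + q + 2}"
  have "double_star p q ({0, 1} \<union> ?A \<union> ?B)
      ({{0, 1}} \<union> {{0, x} | x. x \<in> ?A} \<union> {{1, y} | y. y \<in> ?B})"
    unfolding double_star_def
    by (rule exI[of _ 0], rule exI[of _ 1], rule exI[of _ ?A], rule exI[of _ ?B]) auto
  then show ?thesis by blast
qed

end

theory Submission
  imports Defs
begin

text \<open>
  All edges at a center have different colors, so at least \<open>p + 1\<close> colors are needed; if \<open>p = q\<close> and
  there are only \<open>p + 1\<close> colors, then both centers see every color and both have the zero code.
  Conversely, give the central edge color \<open>1\<close>, the leaf edges at \<open>v\<close> the colors \<open>2, \<dots>, p + 1\<close> and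
  those at \<open>u\<close> the colors \<open>3, \<dots>, q + 2\<close>. Color \<open>1\<close> separates centers from leaves, and color \<open>2\<close>
  separates the two centers. Two leaves at the same center are separated by the color of the edge of
  one of them. Two leaves at different centers are separated by color \<open>2\<close>, which occurs on a single
  leaf edge at \<open>v\<close> and hence has distance at most \<open>1\<close> from the leaves at \<open>v\<close> and \<open>2\<close> from those at \<open>u\<close>.
\<close>

section \<open>Walks, distances and color codes in general graphs\<close>

definition graph_connected :: "'a set \<Rightarrow> 'a set set \<Rightarrow> bool" where
  "graph_connected V E \<longleftrightarrow>
     (\<forall>x\<in>V. \<forall>y\<in>V. \<exists>xs. walk V E xs \<and> hd xs = x \<and> last xs = y)"

text \<open>The junction vertex ends \<open>xs\<close> and starts \<open>ys\<close>;
  \<open>tl\<close> removes its second copy, which would otherwise call for a loop.\<close>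

lemma walk_append_tl:
  assumes "walk V E xs" and "walk V E ys" and "last xs = hd ys"
  shows "walk V E (xs @ tl ys)" and "hd (xs @ tl ys) = hd xs" and "last (xs @ tl ys) = last ys"
  using assms by (cases ys; cases "tl ys"; auto simp: walk_def successively_append_iff)+

lemma walk_rev: "walk V E (rev xs) \<longleftrightarrow> walk V E xs"
  by (simp add: walk_def insert_commute)

text \<open>Reaching one root \<open>r\<close> from everywhere suffices: a walk from
  \<open>x\<close> to \<open>r\<close> continues along the reversed walk from \<open>y\<close> to
  \<open>r\<close>.\<close>

lemma graph_connectedI:
  assumes "\<And>x. x \<in> V \<Longrightarrow> \<exists>xs. walk V E xs \<and> hd xs = x \<and> last xs = r"
  shows "graph_connected V E"
  unfolding graph_connected_def
proof (intro ballI)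
  fix x y
  assume "x \<in> V" "y \<in> V"
  then obtain xs ys where xs: "walk V E xs" "hd xs = x" "last xs = r"
    and ys: "walk V E ys" "hd ys = y" "last ys = r"
    using assms by metis
  have "xs \<noteq> []" "ys \<noteq> []"
    using xs ys by (auto simp: walk_def)
  then show "\<exists>zs. walk V E zs \<and> hd zs = x \<and> last zs = y"
    using walk_append_tl[of V E xs "rev ys"] xs ys
    by (metis walk_rev hd_rev last_rev)
qed

text \<open>Connectedness ensures that the \<open>LEAST\<close> in \<open>vdist\<close> is attained.
  With a threshold instead of an equation, a single walk certifies the bound and no minimality has
  to be shown. The codes are later compared only at the thresholds 0 and 1.\<close>

lemma vdist_le_iff:
  assumes "graph_connected V E" and "x \<in> V" and "y \<in> V"
  shows "vdist V E x y \<le> n \<longleftrightarrow>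
    (\<exists>xs. walk V E xs \<and> hd xs = x \<and> last xs = y \<and> length xs \<le> Suc n)"
proof -
  let ?P = "\<lambda>n. \<exists>xs. walk V E xs \<and> hd xs = x \<and> last xs = y \<and> length xs = Suc n"
  \<comment> \<open>Walks are nonempty, so every length is a successor and fits the form used in
    \<open>vdist\<close>.\<close>
  have P: "\<exists>m. ?P m \<and> Suc m = length xs"
    if "walk V E xs" "hd xs = x" "last xs = y" for xs
    using that by (intro exI[of _ "length xs - 1"]) (auto simp: walk_def)
  show ?thesis
  proof
    assume le: "vdist V E x y \<le> n"
    have "\<exists>m. ?P m"
      using assms P unfolding graph_connected_def by meson
    then have "?P (vdist V E x y)"
      unfolding vdist_def by (rule LeastI_ex)
    with le show "\<exists>xs. walk V E xs \<and> hd xs = x \<and> last xs = y \<and> length xs \<le> Suc n"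
      by fastforce
  next
    assume "\<exists>xs. walk V E xs \<and> hd xs = x \<and> last xs = y \<and> length xs \<le> Suc n"
    then obtain m where m: "?P m" "m \<le> n"
      using P by (metis Suc_le_mono)
    from m(1) have "vdist V E x y \<le> m"
      unfolding vdist_def by (rule Least_le)
    with m(2) show "vdist V E x y \<le> n"
      by simp
  qed
qed

lemma vdist_le_0_iff:
  assumes "graph_connected V E" and "x \<in> V" and "y \<in> V"
  shows "vdist V E x y \<le> 0 \<longleftrightarrow> x = y"
proof
  assume "vdist V E x y \<le> 0"
  then obtain xs where "walk V E xs" "hd xs = x" "last xs = y" "length xs \<le> Suc 0"
    using vdist_le_iff[OF assms] by blast
  then show "x = y"
    by (cases xs) (auto simp: walk_def)
next
  assume "x = y"
  then have "walk V E [x]" "hd [x] = x" "last [x] = y" "length [x] \<le> Suc 0"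
    using assms by (auto simp: walk_def)
  then show "vdist V E x y \<le> 0"
    unfolding vdist_le_iff[OF assms] by blast
qed

lemma vdist_le_1_iff:
  assumes "graph_connected V E" and "x \<in> V" and "y \<in> V"
  shows "vdist V E x y \<le> 1 \<longleftrightarrow> x = y \<or> {x, y} \<in> E"
proof
  assume "vdist V E x y \<le> 1"
  then obtain xs where xs: "walk V E xs" "hd xs = x" "last xs = y" "length xs \<le> Suc 1"
    using vdist_le_iff[OF assms] by blast
  then show "x = y \<or> {x, y} \<in> E"
    by (auto simp: walk_def neq_Nil_conv le_Suc_eq length_Suc_conv)
next
  assume "x = y \<or> {x, y} \<in> E"
  then show "vdist V E x y \<le> 1"
  proof
    assume "x = y"
    then show ?thesis
      using vdist_le_0_iff[OF assms] by simp
  next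
    assume "{x, y} \<in> E"
    then have "walk V E [x, y]" "hd [x, y] = x" "last [x, y] = y" "length [x, y] \<le> Suc 1"
      using assms by (auto simp: walk_def)
    then show ?thesis
      unfolding vdist_le_iff[OF assms] by blast
  qed
qed

text \<open>A minimum over a finite nonempty set is at most \<open>n\<close> exactly when some
  element is. Applied to both nested minima, this leaves only existential quantifiers.\<close>

lemma class_dist_le_iff:
  assumes "finite C" and "C \<noteq> {}" and "\<And>e. e \<in> C \<Longrightarrow> finite e \<and> e \<noteq> {}"
  shows "class_dist V E w C \<le> n \<longleftrightarrow> (\<exists>e\<in>C. \<exists>x\<in>e. vdist V E w x \<le> n)"
proof -
  have "class_dist V E w C \<le> n \<longleftrightarrow> (\<exists>e\<in>C. edge_dist V E w e \<le> n)"
    using assms(1,2) by (simp add: class_dist_def Min_le_iff)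
  also have "\<dots> \<longleftrightarrow> (\<exists>e\<in>C. \<exists>x\<in>e. vdist V E w x \<le> n)"
    using assms(3) by (intro bex_cong) (simp_all add: edge_dist_def Min_le_iff)
  finally show ?thesis .
qed

lemma edge_color_code_eq_iff:
  "edge_color_code V E c k w = edge_color_code V E c k z \<longleftrightarrow>
     (\<forall>i\<in>{1..k}. class_dist V E w (color_class E c i) = class_dist V E z (color_class E c i))"
  by (auto simp: edge_color_code_def)

section \<open>The double star and its class distances\<close>

locale double_star_graph =
  fixes p q :: nat and v u :: 'a and A B V :: "'a set" and E :: "'a set set"
  assumes v_neq_u: "v \<noteq> u"
    and A: "finite A" "card A = p" and B: "finite B" "card B = q"
    and disj: "A \<inter> B = {}" "{v, u} \<inter> (A \<union> B) = {}"
    and V_eq: "V = {v, u} \<union> A \<union> B"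
    and E_eq: "E = {{v, u}} \<union> {{v, x} | x. x \<in> A} \<union> {{u, y} | y. y \<in> B}"
begin

lemma centers_notin: "v \<notin> A" "v \<notin> B" "u \<notin> A" "u \<notin> B"
  using disj by auto

lemma connected: "graph_connected V E"
proof (rule graph_connectedI[where r = v])
  fix w
  assume "w \<in> V"
  then consider "w = v" | "w = u" | "w \<in> A" | "w \<in> B"
    using V_eq by auto
  then show "\<exists>xs. walk V E xs \<and> hd xs = w \<and> last xs = v"
  proof cases
    case 1
    then show ?thesis
      by (intro exI[of _ "[v]"]) (auto simp: walk_def V_eq)
  next
    case 2
    then show ?thesis
      by (intro exI[of _ "[u, v]"]) (auto simp: walk_def V_eq E_eq)
  next
    case 3
    then show ?thesis
      by (intro exI[of _ "[w, v]"]) (auto simp: walk_def V_eq E_eq)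
  next
    case 4
    then show ?thesis
      by (intro exI[of _ "[w, u, v]"]) (auto simp: walk_def V_eq E_eq)
  qed
qed

lemma finite_E: "finite E"
  using A B by (simp add: E_eq)

lemma edge_subset: "e \<in> E \<Longrightarrow> finite e \<and> e \<noteq> {} \<and> e \<subseteq> V"
  by (auto simp: E_eq V_eq)

text \<open>Every color in \<open>{1..k}\<close> is used, so the color class is nonempty and its
  minimum is meaningful.\<close>

lemma class_dist_le:
  assumes "proper_edge_coloring E c k" and "i \<in> {1..k}"
  shows "class_dist V E w (color_class E c i) \<le> n \<longleftrightarrow>
    (\<exists>e\<in>E. c e = i \<and> (\<exists>x\<in>e. vdist V E w x \<le> n))"
proof -
  have "i \<in> c ` E"
    using assms by (simp add: proper_edge_coloring_def)
  then have "color_class E c i \<noteq> {}"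
    by (auto simp: color_class_def)
  then show ?thesis
    using finite_E edge_subset
    by (subst class_dist_le_iff) (auto simp: color_class_def)
qed

lemma class_dist_le_0:
  assumes "proper_edge_coloring E c k" and "i \<in> {1..k}" and "w \<in> V"
  shows "class_dist V E w (color_class E c i) \<le> 0 \<longleftrightarrow> (\<exists>e\<in>E. c e = i \<and> w \<in> e)"
  unfolding class_dist_le[OF assms(1,2)]
  using vdist_le_0_iff[OF connected assms(3)] edge_subset by blast

lemma class_dist_le_1:
  assumes "proper_edge_coloring E c k" and "i \<in> {1..k}" and "w \<in> V"
  shows "class_dist V E w (color_class E c i) \<le> 1 \<longleftrightarrow>
    (\<exists>e\<in>E. c e = i \<and> (\<exists>x\<in>e. w = x \<or> {w, x} \<in> E))"
  unfolding class_dist_le[OF assms(1,2)]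
  using vdist_le_1_iff[OF connected assms(3)] edge_subset by blast

section \<open>Colors at a vertex and the lower bound\<close>

lemma card_edges_at:
  "card {e \<in> E. v \<in> e} = p + 1" "card {e \<in> E. u \<in> e} = q + 1"
proof -
  have "{e \<in> E. v \<in> e} = (\<lambda>x. {v, x}) ` insert u A"
    using v_neq_u centers_notin by (auto simp: E_eq)
  moreover have "inj_on (\<lambda>x. {v, x}) (insert u A)"
    by (auto simp: inj_on_def doubleton_eq_iff)
  ultimately show "card {e \<in> E. v \<in> e} = p + 1"
    using A centers_notin by (simp add: card_image)
  have "{e \<in> E. u \<in> e} = (\<lambda>x. {u, x}) ` insert v B"
    using v_neq_u centers_notin by (auto simp: E_eq)
  moreover have "inj_on (\<lambda>x. {u, x}) (insert v B)"
    by (auto simp: inj_on_def doubleton_eq_iff)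
  ultimately show "card {e \<in> E. u \<in> e} = q + 1"
    using B centers_notin by (simp add: card_image)
qed

text \<open>Any two edges at \<open>w\<close> meet, so properness makes \<open>c\<close> injective
  on them.\<close>

lemma colors_at:
  assumes "proper_edge_coloring E c k"
  shows "c ` {e \<in> E. w \<in> e} \<subseteq> {1..k}" and "card (c ` {e \<in> E. w \<in> e}) = card {e \<in> E. w \<in> e}"
proof -
  show "c ` {e \<in> E. w \<in> e} \<subseteq> {1..k}"
    using assms by (auto simp: proper_edge_coloring_def)
  have "inj_on c {e \<in> E. w \<in> e}"
    using assms unfolding proper_edge_coloring_def inj_on_def by blast
  then show "card (c ` {e \<in> E. w \<in> e}) = card {e \<in> E. w \<in> e}"
    by (rule card_image)
qed

lemma colors_lower_bound:
  assumes "edge_locating_coloring V E c k"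
  shows "p + 1 \<le> k" and "p = q \<Longrightarrow> p + 2 \<le> k"
proof -
  have proper: "proper_edge_coloring E c k" and inj: "inj_on (edge_color_code V E c k) V"
    using assms by (auto simp: edge_locating_coloring_def)
  show ge: "p + 1 \<le> k"
    using card_mono[OF _ colors_at(1)[OF proper, of v]] colors_at(2)[OF proper, of v]
      card_edges_at by simp
  show "p + 2 \<le> k" if "p = q"
  proof (rule ccontr)
    assume "\<not> p + 2 \<le> k"
    with ge have k: "k = p + 1"
      by simp
    have "class_dist V E w (color_class E c i) = 0" if w: "w \<in> {v, u}" and i: "i \<in> {1..k}" for w i
    proof -
      \<comment> \<open>For \<open>p = q\<close> each center has \<open>p + 1 = k\<close> edges, so
        by counting every color occurs at it.\<close>
      have "card (c ` {e \<in> E. w \<in> e}) = card {1..k}"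
        unfolding colors_at(2)[OF proper] using card_edges_at w k \<open>p = q\<close> by auto
      then have "c ` {e \<in> E. w \<in> e} = {1..k}"
        by (intro card_subset_eq colors_at(1)[OF proper]) simp_all
      then have "\<exists>e\<in>E. c e = i \<and> w \<in> e"
        using i by (blast elim: equalityE)
      moreover have "w \<in> V"
        using w V_eq by blast
      ultimately show ?thesis
        using class_dist_le_0[OF proper i, of w] by simp
    qed
    then have "edge_color_code V E c k v = edge_color_code V E c k u"
      by (simp add: edge_color_code_eq_iff)
    with inj v_neq_u V_eq show False
      by (auto dest: inj_onD)
  qed
qed

section \<open>A coloring that attains the bound\<close>

lemma edge_cases:
  assumes "e \<in> E"
  obtains "e = {v, u}" | x where "x \<in> A" "e = {v, x}" | y where "y \<in> B" "e = {u, y}"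
  using assms by (auto simp: E_eq)

lemma bex_edge_iff:
  "(\<exists>e\<in>E. P e) \<longleftrightarrow> P {v, u} \<or> (\<exists>x\<in>A. P {v, x}) \<or> (\<exists>y\<in>B. P {u, y})"
  by (auto simp: E_eq)

text \<open>The colors reach \<open>p + 1\<close> at \<open>v\<close> and \<open>q + 2\<close> at
  \<open>u\<close>; the maximum treats both cases of the theorem at once.\<close>

lemma ex_edge_locating_coloring:
  assumes "p \<ge> 1"
  shows "\<exists>c. edge_locating_coloring V E c (max (p + 1) (q + 2))"
proof -
  let ?k = "max (p + 1) (q + 2)"
  obtain f where f: "bij_betw f A {2..<p + 2}"
    using A by (metis bij_betw_iff_card finite_atLeastLessThan card_atLeastLessThan add_diff_cancel_right')
  obtain g where g: "bij_betw g B {3..<q + 3}"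
    using B by (metis bij_betw_iff_card finite_atLeastLessThan card_atLeastLessThan add_diff_cancel_right')
  \<comment> \<open>Leaves get labels above 1 and centers the default 1. The maximum over an edge is
    thus the label of its leaf, or 1 on the central edge.\<close>
  define h where "h w = (if w \<in> A then f w else if w \<in> B then g w else 1)" for w
  define c where "c e = Max (h ` e)" for e
  have fA: "2 \<le> f x" "f x < p + 2" if "x \<in> A" for x
    using f that by (auto simp: bij_betw_def)
  have gB: "3 \<le> g y" "g y < q + 3" if "y \<in> B" for y
    using g that by (auto simp: bij_betw_def)
  have f_inj: "f x = f x' \<longleftrightarrow> x = x'" if "x \<in> A" "x' \<in> A" for x x'
    using f that by (auto simp: bij_betw_def dest: inj_onD)
  have g_inj: "g y = g y' \<longleftrightarrow> y = y'" if "y \<in> B" "y' \<in> B" for y y'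
    using g that by (auto simp: bij_betw_def dest: inj_onD)
  have c_vu: "c {v, u} = 1"
    using centers_notin by (simp add: c_def h_def)
  have c_A: "c {v, x} = f x" if "x \<in> A" for x
    using centers_notin that fA[OF that] by (simp add: c_def h_def)
  have c_B: "c {u, y} = g y" if "y \<in> B" for y
  proof -
    have "y \<notin> A"
      using disj that by auto
    then show ?thesis
      using centers_notin that gB[OF that] by (simp add: c_def h_def)
  qed
  have c_image: "c ` E = {1} \<union> f ` A \<union> g ` B"
  proof -
    have "E = {{v, u}} \<union> (\<lambda>x. {v, x}) ` A \<union> (\<lambda>y. {u, y}) ` B"
      by (auto simp: E_eq)
    then show ?thesis
      by (simp add: image_Un image_image c_vu c_A c_B)
  qed
  \<comment> \<open>There is no gap: \<open>p \<ge> 1\<close> makes color 2 occur at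
    \<open>v\<close>, and the colors of \<open>g\<close> start at 3.\<close>
  also have "\<dots> = {1..?k}"
    using f g assms by (auto simp: bij_betw_def)
  finally have range: "c ` E = {1..?k}" .
  \<comment> \<open>Leaf edges at different centers are disjoint, so the colors shared by
    \<open>f\<close> and \<open>g\<close> cause no conflict.\<close>
  have "c e \<noteq> c e'" if "e \<in> E" "e' \<in> E" "e \<noteq> e'" "e \<inter> e' \<noteq> {}" for e e'
    using that v_neq_u disj fA gB
    by (elim edge_cases) (force simp: c_vu c_A c_B f_inj g_inj)+
  then have proper: "proper_edge_coloring E c ?k"
    using range by (auto simp: proper_edge_coloring_def)
  have two: "2 \<in> {1..?k}" and one: "1 \<in> {1..?k}"
    by auto
  \<comment> \<open>Color 2 is avoided by \<open>g\<close> and by the central edge, so its class is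
    the single edge \<open>{v, a}\<close>.\<close>
  obtain a where a: "a \<in> A" "f a = 2"
  proof -
    have "2 \<in> f ` A"
      using f assms by (auto simp: bij_betw_def)
    then show ?thesis
      using that by force
  qed
  have at_1: "(\<exists>e\<in>E. c e = 1 \<and> w \<in> e) \<longleftrightarrow> w \<in> {v, u}" for w
    unfolding bex_edge_iff using c_vu c_A c_B fA gB by fastforce
  have class_2: "e \<in> E \<and> c e = 2 \<longleftrightarrow> e = {v, a}" for e
  proof
    assume "e \<in> E \<and> c e = 2"
    then have e: "e \<in> E" and ce: "c e = 2"
      by auto
    from e show "e = {v, a}"
    proof (cases rule: edge_cases)
      case 1
      then show ?thesis
        using ce c_vu by simp
    next
      case (2 x)
      then show ?thesis
        using ce c_A f_inj[of x a] a by simp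
    next
      case (3 y)
      then show ?thesis
        using ce c_B gB[of y] by simp
    qed
  next
    assume "e = {v, a}"
    then show "e \<in> E \<and> c e = 2"
      using a c_A by (auto simp: E_eq)
  qed
  have bex_2: "(\<exists>e\<in>E. c e = 2 \<and> Q e) \<longleftrightarrow> Q {v, a}" for Q
    using class_2 by metis
  have at_A: "(\<exists>e\<in>E. c e = i \<and> x \<in> e) \<longleftrightarrow> i = f x" if "x \<in> A" for x i
    unfolding bex_edge_iff using that c_A disj by auto
  have at_B: "(\<exists>e\<in>E. c e = i \<and> y \<in> e) \<longleftrightarrow> i = g y" if "y \<in> B" for y i
    unfolding bex_edge_iff using that c_B disj by auto
  have f_range: "f x \<in> {1..?k}" if "x \<in> A" for x
    using fA[OF that] by auto
  have g_range: "g y \<in> {1..?k}" if "y \<in> B" for y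
    using gB[OF that] by auto
  have near_A: "\<exists>e\<in>E. c e = 2 \<and> (\<exists>z\<in>e. x = z \<or> {x, z} \<in> E)" if "x \<in> A" for x
    unfolding bex_2 using that by (auto simp: E_eq insert_commute)
  \<comment> \<open>The only neighbor of a leaf at \<open>u\<close> is \<open>u\<close>, which is
    not an endpoint of \<open>{v, a}\<close>.\<close>
  have far_B: "\<not> (\<exists>e\<in>E. c e = 2 \<and> (\<exists>z\<in>e. y = z \<or> {y, z} \<in> E))" if "y \<in> B" for y
  proof -
    have "y \<notin> {v, a}" "{y, v} \<notin> E" "{y, a} \<notin> E"
      using that a(1) disj v_neq_u by (auto simp: E_eq doubleton_eq_iff)
    then show ?thesis
      unfolding bex_2 by blast
  qed
  have "inj_on (edge_color_code V E c ?k) V"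
  proof (rule inj_onI)
    fix w z
    assume w: "w \<in> V" and z: "z \<in> V"
      and eq: "edge_color_code V E c ?k w = edge_color_code V E c ?k z"
    have same_dist: "class_dist V E w (color_class E c i) = class_dist V E z (color_class E c i)"
      if "i \<in> {1..?k}" for i
      using eq that unfolding edge_color_code_eq_iff by (rule bspec)
    \<comment> \<open>Equal codes vanish at the same positions, so \<open>w\<close> and
      \<open>z\<close> see the same colors.\<close>
    have same_0: "(\<exists>e\<in>E. c e = i \<and> w \<in> e) \<longleftrightarrow> (\<exists>e\<in>E. c e = i \<and> z \<in> e)"
      if "i \<in> {1..?k}" for i
      using class_dist_le_0[OF proper that w] class_dist_le_0[OF proper that z] same_dist[OF that]
      by (simp only:)
    have same_1: "(\<exists>e\<in>E. c e = 2 \<and> (\<exists>x\<in>e. w = x \<or> {w, x} \<in> E)) \<longleftrightarrow>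
        (\<exists>e\<in>E. c e = 2 \<and> (\<exists>x\<in>e. z = x \<or> {z, x} \<in> E))"
      using class_dist_le_1[OF proper two w] class_dist_le_1[OF proper two z] same_dist[OF two]
      by (simp only:)
    have centers: "w \<in> {v, u} \<longleftrightarrow> z \<in> {v, u}"
      using same_0[OF one] at_1 by simp
    have at_2: "w \<in> {v, a} \<longleftrightarrow> z \<in> {v, a}"
      using same_0[OF two] unfolding bex_2 .
    consider "w \<in> {v, u}" "z \<in> {v, u}" | "w \<in> A" "z \<in> A" | "w \<in> B" "z \<in> B"
      | "w \<in> A" "z \<in> B" | "w \<in> B" "z \<in> A"
      using w z centers V_eq by auto
    then show "w = z"
    proof cases
      case 1
      then show ?thesis
        using at_2 a(1) v_neq_u centers_notin by auto
    next
      case 2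
      then show ?thesis
        using same_0[OF f_range[of w]] at_A f_inj by simp
    next
      case 3
      then show ?thesis
        using same_0[OF g_range[of w]] at_B g_inj by simp
    next
      case 4
      then show ?thesis
        using same_1 near_A far_B by blast
    next
      case 5
      then show ?thesis
        using same_1 near_A far_B by blast
    qed
  qed
  then show ?thesis
    using proper unfolding edge_locating_coloring_def by blast
qed

end

theorem theorem20:
  fixes p q :: nat and V :: "'a set" and E :: "'a set set"
  assumes "p \<ge> q" and "q \<ge> 1" and "double_star p q V E"
  shows "(p > q \<longrightarrow> edge_locating_chromatic_number V E = p + 1) \<and>
         (p = q \<longrightarrow> edge_locating_chromatic_number V E = p + 2)"
proof -
  obtain v u A B where "double_star_graph p q v u A B V E"
    using assms(3) unfolding double_star_def
    by (elim exE conjE) (rule that, rule double_star_graph.intro)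
  then interpret double_star_graph p q v u A B V E .
  have least: "edge_locating_chromatic_number V E = max (p + 1) (q + 2)"
    unfolding edge_locating_chromatic_number_def
  proof (rule Least_equality)
    show "\<exists>c. edge_locating_coloring V E c (max (p + 1) (q + 2))"
      using ex_edge_locating_coloring assms by simp
    show "max (p + 1) (q + 2) \<le> k" if "\<exists>c. edge_locating_coloring V E c k" for k
    proof -
      obtain c where c: "edge_locating_coloring V E c k"
        using \<open>\<exists>c. edge_locating_coloring V E c k\<close> by blast
      \<comment> \<open>Since \<open>q \<le> p\<close>, the value \<open>q + 2\<close> exceeds
        \<open>p + 1\<close> only for \<open>p = q\<close>, where the second bound applies.\<close>
      show ?thesis
        using colors_lower_bound(1)[OF c] colors_lower_bound(2)[OF c] assms(1) by linarith
    qed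
  qed
  show ?thesis
    using least assms by auto
qed

end
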